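(* Let $\Phi$ be a (possibly reducible) finite crystallographic root system with irreducible components $\Phi_1,\dots,\Phi_k$. Let $\mathbb E_i=\mathrm{Span}(\Phi_i)$, let $\mathcal P_i$ be the root polytope of $\Phi_i$, and for a face $F$ of $\mathcal P_\Phi$ set $F_i=F\cap \mathbb E_i$. (1) The map $F\mapsto (F_1,\dots,F_k)$ is a bijection between the proper faces of $\mathcal P_\Phi$ and the $k$-tuples $(\overline F_1,\dots,\overline F_k)$ where $\overline F_i$ is a proper face of $\mathcal P_i$ for every $i\in\{1,\dots,k\}$. (2) A proper face $F$ of $\mathcal P_\Phi$ has dimension $\dim F=k-1+\sum_{i=1}^k\dim F_i$. (3) A face $F$ of $\mathcal P_\Phi$ is standard if and only if $F_i$ is a standard face of $\mathcal P_i$ for all $i\in\{1,\dots,k\}$.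
   Context: $\Phi$ is a finite reduced crystallographic root system in the real vector space $\mathbb E=\mathrm{Span}_{\mathbb R}\Phi$ with (Weyl-group-invariant) positive definite bilinear form $(\cdot,\cdot)$; $\Pi$ is a set of simple roots and $\Pi_i=\Pi\cap\Phi_i$. $\mathcal C=\{x\in\mathbb E:(x,\alpha)\ge 0\ \forall \alpha\in\Pi\}$ is the (closed) fundamental chamber, and $\mathcal C_i=\mathcal C\cap\mathbb E_i$ is that of $\Phi_i$ with respect to $\Pi_i$. The root polytope of a root system is the convex hull of all its roots; $\mathcal P_i=\mathcal P_\Phi\cap\mathbb E_i$. A proper face is a possibly empty face different from the whole polytope. The empty face has dimension $-1$. A face $F$ of $\mathcal P_\Phi$ (resp. $\mathcal P_i$) is standard if either its relative interior (interior within its affine hull) meets $\mathcal C$ (resp. $\mathcal C_i$), or $F=\emptyset$. *)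

theory Defs
  imports "HOL-Analysis.Analysis"
begin

text \<open>
  A root system is a finite subset of a Euclidean space; it lives in the subspace
  \<^term>\<open>span \<Phi>\<close>, which may be smaller than the ambient type. The invariant
  positive definite form is the inner product; its Weyl group invariance is automatic,
  since the reflections below are orthogonal for it.
\<close>

definition root_reflection :: "'a::euclidean_space \<Rightarrow> 'a \<Rightarrow> 'a" where
  "root_reflection \<alpha> x = x - (2 * (x \<bullet> \<alpha>) / (\<alpha> \<bullet> \<alpha>)) *\<^sub>R \<alpha>"

text \<open>Reduced and crystallographic, but possibly reducible.\<close>

definition root_system :: "'a::euclidean_space set \<Rightarrow> bool" where
  "root_system \<Phi> \<longleftrightarrow>
     finite \<Phi> \<and> 0 \<notin> \<Phi> \<and>
     (\<forall>\<alpha>\<in>\<Phi>. root_reflection \<alpha> ` \<Phi> = \<Phi>) \<and>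
     (\<forall>\<alpha>\<in>\<Phi>. \<forall>\<beta>\<in>\<Phi>. 2 * (\<beta> \<bullet> \<alpha>) / (\<alpha> \<bullet> \<alpha>) \<in> \<int>) \<and>
     (\<forall>\<alpha>\<in>\<Phi>. \<forall>c::real. c *\<^sub>R \<alpha> \<in> \<Phi> \<longrightarrow> c = 1 \<or> c = - 1)"

definition irreducible_root_system :: "'a::euclidean_space set \<Rightarrow> bool" where
  "irreducible_root_system \<Phi> \<longleftrightarrow>
     root_system \<Phi> \<and> \<Phi> \<noteq> {} \<and>
     \<not> (\<exists>A B. A \<noteq> {} \<and> B \<noteq> {} \<and> A \<union> B = \<Phi> \<and> A \<inter> B = {} \<and>
              (\<forall>\<alpha>\<in>A. \<forall>\<beta>\<in>B. \<alpha> \<bullet> \<beta> = 0))"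

definition irreducible_components :: "'a::euclidean_space set \<Rightarrow> 'a set set" where
  "irreducible_components \<Phi> =
     {\<Psi>. \<Psi> \<subseteq> \<Phi> \<and> irreducible_root_system \<Psi> \<and> (\<forall>\<alpha>\<in>\<Psi>. \<forall>\<beta>\<in>\<Phi> - \<Psi>. \<alpha> \<bullet> \<beta> = 0)}"

definition simple_roots :: "'a::euclidean_space set \<Rightarrow> 'a set \<Rightarrow> bool" where
  "simple_roots \<Phi> \<Delta> \<longleftrightarrow>
     \<Delta> \<subseteq> \<Phi> \<and> independent \<Delta> \<and>
     (\<forall>\<beta>\<in>\<Phi>. \<exists>c::'a \<Rightarrow> nat.
        \<beta> = (\<Sum>\<alpha>\<in>\<Delta>. real (c \<alpha>) *\<^sub>R \<alpha>) \<or> \<beta> = - (\<Sum>\<alpha>\<in>\<Delta>. real (c \<alpha>) *\<^sub>R \<alpha>))"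

definition fundamental_chamber :: "'a::euclidean_space set \<Rightarrow> 'a set \<Rightarrow> 'a set" where
  "fundamental_chamber \<Phi> \<Delta> = {x \<in> span \<Phi>. \<forall>\<alpha>\<in>\<Delta>. 0 \<le> x \<bullet> \<alpha>}"

definition root_polytope :: "'a::euclidean_space set \<Rightarrow> 'a set" where
  "root_polytope \<Phi> = convex hull \<Phi>"

text \<open>The empty set is a proper face of every nonempty polytope.\<close>

definition proper_face :: "'a::euclidean_space set \<Rightarrow> 'a set \<Rightarrow> bool" where
  "proper_face F P \<longleftrightarrow> F face_of P \<and> F \<noteq> P"

definition standard_face :: "'a::euclidean_space set \<Rightarrow> 'a set \<Rightarrow> 'a set \<Rightarrow> bool" where
  "standard_face \<Phi> \<Delta> F \<longleftrightarrow>
     F face_of root_polytope \<Phi> \<and>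
     (F = {} \<or> rel_interior F \<inter> fundamental_chamber \<Phi> \<Delta> \<noteq> {})"

end

theory Submission
  imports Defs
begin

text \<open>
  A root polytope contains the origin in its relative interior, so its proper faces are exactly
  the sets cut out of it by hyperplanes \<open>a \<bullet> x = 1\<close> with \<open>a \<bullet> x \<le> 1\<close> on all
  roots; the empty face corresponds to \<open>a = 0\<close>. Because the components are orthogonal, such a
  functional on the whole space is the same as an independent choice of one for every component,
  which gives the bijection. Adjoining the origin raises the dimension of a proper face by one and
  makes the dimensions add up. Finally, a face is the convex hull of the orthogonal pieces
  \<open>F\<^sub>i\<close>, so its relatively interior points are the strictly positive convex combinations of
  relatively interior points of the nonempty pieces, and dominance can be tested componentwise.
\<close>

section \<open>Faces of symmetric polytopes\<close>

lemma convex_hull_le_iff: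
  fixes a :: "'a::real_inner"
  shows "(\<forall>x\<in>convex hull S. a \<bullet> x \<le> b) \<longleftrightarrow> (\<forall>x\<in>S. a \<bullet> x \<le> b)"
proof
  assume "\<forall>x\<in>S. a \<bullet> x \<le> b"
  then have "convex hull S \<subseteq> {x. a \<bullet> x \<le> b}"
    by (intro hull_minimal convex_halfspace_le) auto
  then show "\<forall>x\<in>convex hull S. a \<bullet> x \<le> b" by auto
qed (simp add: hull_inc)

text \<open>The slice is a face, and every face of a finitely generated hull is the hull of some of
  the generators; all of these must lie on the hyperplane. This reduces faces to finite subsets of
  \<open>S\<close>.\<close>

lemma convex_hull_Int_supporting_hyperplane:
  fixes S :: "'a::euclidean_space set"
  assumes "finite S" "\<forall>x\<in>S. a \<bullet> x \<le> b"
  shows "convex hull S \<inter> {x. a \<bullet> x = b} = convex hull {x\<in>S. a \<bullet> x = b}"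
proof
  have "(convex hull S \<inter> {x. a \<bullet> x = b}) face_of (convex hull S)"
    using assms convex_hull_le_iff[of S a b]
    by (intro face_of_Int_supporting_hyperplane_le) auto
  then obtain T where T: "T \<subseteq> S" "convex hull S \<inter> {x. a \<bullet> x = b} = convex hull T"
    using face_of_convex_hull_subset assms(1) finite_imp_compact by metis
  have "T \<subseteq> {x\<in>S. a \<bullet> x = b}"
    using T hull_subset[of T convex] by auto
  then show "convex hull S \<inter> {x. a \<bullet> x = b} \<subseteq> convex hull {x\<in>S. a \<bullet> x = b}"
    using T hull_mono by metis
next
  show "convex hull {x\<in>S. a \<bullet> x = b} \<subseteq> convex hull S \<inter> {x. a \<bullet> x = b}"
    by (intro hull_minimal convex_Int convex_hyperplane) (auto simp: hull_inc)
qed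

lemma uminus_convex_hull:
  fixes S :: "'a::real_vector set"
  assumes "\<And>x. x \<in> S \<Longrightarrow> - x \<in> S"
  shows "uminus ` (convex hull S) = convex hull S"
proof -
  have "uminus ` S = S"
    using assms by (force simp: image_iff)
  then show ?thesis
    using convex_hull_linear_image[of uminus S]
    by (simp add: Real_Vector_Spaces.linear_iff)
qed

text \<open>Negation preserves the relative interior, which is convex, so it contains the midpoint
  of \<open>x\<close> and \<open>- x\<close>.\<close>

lemma zero_in_rel_interior_symmetric:
  fixes C :: "'a::euclidean_space set"
  assumes "convex C" "C \<noteq> {}" "uminus ` C = C"
  shows "0 \<in> rel_interior C"
proof -
  obtain x where x: "x \<in> rel_interior C"
    using rel_interior_eq_empty assms by blast
  have "inj (uminus :: 'a \<Rightarrow> 'a)" by (simp add: inj_def)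
  then have "rel_interior (uminus ` C) = uminus ` rel_interior C"
    by (intro rel_interior_injective_linear_image)
       (auto simp: linear_linear Real_Vector_Spaces.linear_iff)
  then have "- x \<in> rel_interior C"
    using x assms(3) by auto
  then have "(1/2) *\<^sub>R x + (1/2) *\<^sub>R (- x) \<in> rel_interior C"
    using x convex_rel_interior[OF assms(1)] by (intro convexD) auto
  then show ?thesis by simp
qed

lemma zero_in_rel_interior_convex_hull:
  fixes S :: "'a::euclidean_space set"
  assumes "S \<noteq> {}" "\<And>x. x \<in> S \<Longrightarrow> - x \<in> S"
  shows "0 \<in> rel_interior (convex hull S)"
  using assms by (intro zero_in_rel_interior_symmetric uminus_convex_hull) auto

text \<open>Faces of polytopes are exposed. As the origin is relatively interior, the offset of the
  hyperplane is positive and can be scaled to 1. Conversely, such a slice misses the origin, which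
  lies in the hull, so it is proper.\<close>

lemma proper_face_convex_hull_iff:
  fixes S :: "'a::euclidean_space set"
  assumes "finite S" "S \<noteq> {}" "\<And>x. x \<in> S \<Longrightarrow> - x \<in> S"
  shows "proper_face F (convex hull S) \<longleftrightarrow>
    (\<exists>a. (\<forall>x\<in>S. a \<bullet> x \<le> 1) \<and> F = convex hull S \<inter> {x. a \<bullet> x = 1})"
    (is "?L \<longleftrightarrow> ?R")
proof
  let ?P = "convex hull S"
  have 0: "0 \<in> ?P"
    using zero_in_rel_interior_convex_hull[OF assms(2,3)] rel_interior_subset by blast
  show ?R if F: ?L
  proof (cases "F = {}")
    case True
    then show ?thesis by (intro exI[of _ 0]) auto
  next
    case False
    have "F exposed_face_of ?P"
      using F assms(1) unfolding proper_face_def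
      by (metis exposed_face_of_polyhedron polytope_convex_hull polytope_imp_polyhedron)
    then obtain a b where ab: "?P \<subseteq> {x. a \<bullet> x \<le> b}" "F = ?P \<inter> {x. a \<bullet> x = b}"
      unfolding exposed_face_of_def by auto
    \<comment> \<open>For \<open>b = 0\<close> the origin would lie in \<open>F\<close>, but a
      proper face is disjoint from the relative interior.\<close>
    have "b \<noteq> 0"
      using F ab 0 face_of_disjoint_rel_interior[of F ?P]
        zero_in_rel_interior_convex_hull[OF assms(2,3)]
      unfolding proper_face_def by auto
    moreover have "b \<ge> 0" using ab(1) 0 by auto
    ultimately have b: "b > 0" by simp
    have "x \<bullet> (a /\<^sub>R b) = 1 \<longleftrightarrow> x \<bullet> a = b" "x \<bullet> (a /\<^sub>R b) \<le> 1 \<longleftrightarrow> x \<bullet> a \<le> b" for x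
      using b by (auto simp: field_simps)
    then show ?thesis
      using ab convex_hull_le_iff[of S a b]
      by (intro exI[of _ "a /\<^sub>R b"]) (auto simp: inner_commute)
  qed
  show ?L if ?R
  proof -
    obtain a where a: "\<forall>x\<in>S. a \<bullet> x \<le> 1" "F = ?P \<inter> {x. a \<bullet> x = 1}" using \<open>?R\<close> by auto
    have "F face_of ?P"
      unfolding a(2) using a(1) convex_hull_le_iff[of S a 1]
      by (intro face_of_Int_supporting_hyperplane_le) auto
    moreover have "0 \<notin> F" using a(2) by simp
    ultimately show ?thesis
      using 0 unfolding proper_face_def by auto
  qed
qed

section \<open>Orthogonal pieces\<close>

lemma orthogonal_span_span:
  fixes A B :: "'a::real_inner set"
  assumes "\<And>x y. x \<in> A \<Longrightarrow> y \<in> B \<Longrightarrow> x \<bullet> y = 0" "x \<in> span A" "y \<in> span B"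
  shows "x \<bullet> y = 0"
proof -
  have 1: "x \<bullet> y = 0" if "y \<in> B" for y
    using assms(2) by (rule span_induct[OF _ subspace_hyperplane2]) (simp add: assms(1) that)
  show ?thesis
    using assms(3) by (rule span_induct[OF _ subspace_hyperplane]) (simp add: 1)
qed

lemma dim_Union_orthogonal:
  fixes T :: "'i \<Rightarrow> 'a::euclidean_space set"
  assumes "finite I"
    and "\<And>i j x y. i \<in> I \<Longrightarrow> j \<in> I \<Longrightarrow> i \<noteq> j \<Longrightarrow> x \<in> T i \<Longrightarrow> y \<in> T j \<Longrightarrow> x \<bullet> y = 0"
  shows "dim (\<Union>i\<in>I. T i) = (\<Sum>i\<in>I. dim (T i))"
  using assms
proof (induction I rule: finite_induct)
  case (insert i I)
  have "dim (T i \<union> (\<Union>i\<in>I. T i)) = dim (T i) + dim (\<Union>i\<in>I. T i)"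
    using insert.hyps insert.prems by (intro dim_orthogonal_sum) blast
  moreover have "dim (\<Union>i\<in>I. T i) = (\<Sum>i\<in>I. dim (T i))"
    using insert.prems by (intro insert.IH) blast
  ultimately show ?case
    using insert.hyps by simp
qed simp

text \<open>The affine hull misses the origin, so adjoining 0 raises the affine dimension by exactly
  one and turns it into the linear dimension. For \<open>T = {}\<close> this reads -1 = 0 - 1, in
  line with the dimension of the empty face.\<close>

lemma aff_dim_in_hyperplane_one:
  fixes T :: "'a::euclidean_space set"
  assumes "\<And>x. x \<in> T \<Longrightarrow> a \<bullet> x = 1"
  shows "aff_dim T = int (dim T) - 1"
proof -
  have "affine hull T \<subseteq> {x. a \<bullet> x = 1}"
    using assms by (intro hull_minimal affine_hyperplane) auto
  then have "0 \<notin> affine hull T" by auto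
  then have "aff_dim (insert 0 T) = aff_dim T + 1"
    by (simp add: aff_dim_insert)
  moreover have "aff_dim (insert 0 T) = int (dim (insert 0 T))"
    by (intro aff_dim_zero) (simp add: hull_inc)
  ultimately show ?thesis
    by (metis add_diff_cancel_right' dim_span span_insert_0)
qed

text \<open>Write a point of the hull as \<open>u *\<^sub>R s + v *\<^sub>R t\<close>. If it lies in
  \<open>span A\<close>, then \<open>v *\<^sub>R t\<close> lies in two orthogonal subspaces and
  vanishes; since 0 is in the hull of \<open>A\<close>, the missing weight \<open>v\<close> can be
  put on 0.\<close>

lemma convex_hull_Un_orthogonal_Int_span:
  fixes A B :: "'a::euclidean_space set"
  assumes orth: "\<And>x y. x \<in> A \<Longrightarrow> y \<in> B \<Longrightarrow> x \<bullet> y = 0" and 0: "0 \<in> convex hull A"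
  shows "convex hull (A \<union> B) \<inter> span A = convex hull A"
proof
  show "convex hull A \<subseteq> convex hull (A \<union> B) \<inter> span A"
    by (simp add: hull_mono convex_hull_subset_span)
  show "convex hull (A \<union> B) \<inter> span A \<subseteq> convex hull A"
  proof (cases "B = {}")
    case False
    show ?thesis
    proof
      fix x assume x: "x \<in> convex hull (A \<union> B) \<inter> span A"
      have "convex hull (A \<union> B) = convex hull (convex hull A \<union> convex hull B)"
        by (rule hull_Un) (simp add: convex_Inter)
      moreover have ne: "convex hull A \<noteq> {}" "convex hull B \<noteq> {}"
        using 0 False by auto
      ultimately obtain u v s t where uv: "u \<ge> 0" "v \<ge> 0" "u + v = 1"
          "s \<in> convex hull A" "t \<in> convex hull B" "x = u *\<^sub>R s + v *\<^sub>R t"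
        using x convex_hull_union_two[OF convex_convex_hull ne(1) convex_convex_hull ne(2)]
        by blast
      have "v *\<^sub>R t = x - u *\<^sub>R s" using uv by simp
      also have "\<dots> \<in> span A"
        using x uv(4) convex_hull_subset_span[of A] by (blast intro: span_diff span_scale)
      finally have "v *\<^sub>R t \<in> span A" .
      moreover have "v *\<^sub>R t \<in> span B"
        using uv(5) convex_hull_subset_span[of B] by (blast intro: span_scale)
      ultimately have "(v *\<^sub>R t) \<bullet> (v *\<^sub>R t) = 0"
        using orthogonal_span_span[OF orth] by blast
      then have "x = u *\<^sub>R s + v *\<^sub>R 0" using uv by simp
      also have "\<dots> \<in> convex hull A"
        using uv 0 by (intro convexD) auto
      finally show "x \<in> convex hull A" .
    qed
  qed simp
qed

section \<open>Finite symmetric sets in mutually orthogonal subspaces\<close>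

text \<open>Isolates the properties of the irreducible components on which the face arguments rest;
  \<open>S i\<close> stands for the i-th component and \<open>total\<close> for the whole root
  system.\<close>

locale orthogonal_pieces =
  fixes I :: "'i set" and S :: "'i \<Rightarrow> 'a::euclidean_space set"
  assumes finite_index: "finite I"
    and finite_piece: "i \<in> I \<Longrightarrow> finite (S i)"
    and piece_nonempty: "i \<in> I \<Longrightarrow> S i \<noteq> {}"
    and uminus_piece: "i \<in> I \<Longrightarrow> x \<in> S i \<Longrightarrow> - x \<in> S i"
    and orthogonal_pieces: "i \<in> I \<Longrightarrow> j \<in> I \<Longrightarrow> i \<noteq> j \<Longrightarrow> x \<in> S i \<Longrightarrow> y \<in> S j \<Longrightarrow> x \<bullet> y = 0"
    and index_nonempty: "I \<noteq> {}"
begin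

definition total :: "'a set" where
  "total = (\<Union>i\<in>I. S i)"

lemma finite_total: "finite total"
  using finite_index finite_piece by (auto simp: total_def)

lemma total_nonempty: "total \<noteq> {}"
  using index_nonempty piece_nonempty by (auto simp: total_def)

lemma uminus_total: "x \<in> total \<Longrightarrow> - x \<in> total"
  using uminus_piece by (auto simp: total_def)

lemma zero_in_rel_interior_piece: "i \<in> I \<Longrightarrow> 0 \<in> rel_interior (convex hull S i)"
  by (intro zero_in_rel_interior_convex_hull piece_nonempty uminus_piece)

lemma zero_in_rel_interior_total: "0 \<in> rel_interior (convex hull total)"
  by (intro zero_in_rel_interior_convex_hull total_nonempty uminus_total)

lemma proper_face_piece:
  assumes "i \<in> I"
  shows "proper_face F (convex hull S i) \<longleftrightarrow>
    (\<exists>a. (\<forall>x\<in>S i. a \<bullet> x \<le> 1) \<and> F = convex hull S i \<inter> {x. a \<bullet> x = 1})"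
  using assms finite_piece piece_nonempty uminus_piece
  by (intro proper_face_convex_hull_iff) auto

lemma proper_face_total:
  "proper_face F (convex hull total) \<longleftrightarrow>
    (\<exists>a. (\<forall>x\<in>total. a \<bullet> x \<le> 1) \<and> F = convex hull total \<inter> {x. a \<bullet> x = 1})"
  using finite_total total_nonempty uminus_total by (intro proper_face_convex_hull_iff) auto

lemma convex_hull_total_Int_span:
  assumes "i \<in> I"
  shows "convex hull total \<inter> span (S i) = convex hull S i"
proof -
  have "total = S i \<union> (\<Union>j\<in>I - {i}. S j)"
    using assms by (auto simp: total_def)
  moreover have "0 \<in> convex hull S i"
    using zero_in_rel_interior_piece[OF assms] rel_interior_subset by blast
  ultimately show ?thesis
    using convex_hull_Un_orthogonal_Int_span[of "S i" "\<Union>j\<in>I - {i}. S j"]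
      orthogonal_pieces assms by fastforce
qed

text \<open>Orthogonality kills every term except the one with index \<open>j\<close>. Used with
  \<open>J = I\<close> and unit weights to glue functionals, and with positive weights on the
  nonempty pieces to test dominance.\<close>

lemma inner_sum_pieces:
  assumes "J \<subseteq> I" "\<And>i. i \<in> J \<Longrightarrow> s i \<in> span (S i)" "j \<in> I" "y \<in> span (S j)"
  shows "(\<Sum>i\<in>J. c i *\<^sub>R s i) \<bullet> y = (if j \<in> J then c j * (s j \<bullet> y) else 0)"
proof -
  have "finite J" using assms(1) finite_index finite_subset by blast
  have "s i \<bullet> y = 0" if "i \<in> J" "i \<noteq> j" for i
    using orthogonal_span_span[of "S i" "S j" "s i" y] orthogonal_pieces assms that by blast
  then have "(\<Sum>i\<in>J. c i *\<^sub>R s i) \<bullet> y = (\<Sum>i\<in>J. if i = j then c j * (s j \<bullet> y) else 0)"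
    unfolding inner_sum_left by (intro sum.cong) auto
  then show ?thesis
    using \<open>finite J\<close> by simp
qed

section \<open>Proper faces and their pieces\<close>

text \<open>The functional that cuts out \<open>F\<close> also cuts out each piece. The first form
  exhibits the piece as a slice; the second gives its finite generating set, which serves for
  comparing faces and counting dimensions.\<close>

lemma face_total_Int_span:
  assumes "\<forall>x\<in>total. a \<bullet> x \<le> 1" "F = convex hull total \<inter> {x. a \<bullet> x = 1}" "i \<in> I"
  shows "F \<inter> span (S i) = convex hull S i \<inter> {x. a \<bullet> x = 1}"
    and "F \<inter> span (S i) = convex hull {x\<in>S i. a \<bullet> x = 1}"
proof -
  show *: "F \<inter> span (S i) = convex hull S i \<inter> {x. a \<bullet> x = 1}"
    using convex_hull_total_Int_span[OF assms(3)] assms(2) by auto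
  show "F \<inter> span (S i) = convex hull {x\<in>S i. a \<bullet> x = 1}"
    unfolding * using assms finite_piece
    by (intro convex_hull_Int_supporting_hyperplane) (auto simp: total_def)
qed

lemma proper_face_Int_span:
  assumes "proper_face F (convex hull total)" "i \<in> I"
  shows "proper_face (F \<inter> span (S i)) (convex hull S i)"
proof -
  obtain a where a: "\<forall>x\<in>total. a \<bullet> x \<le> 1" "F = convex hull total \<inter> {x. a \<bullet> x = 1}"
    using assms(1) proper_face_total by auto
  moreover have "\<forall>x\<in>S i. a \<bullet> x \<le> 1"
    using a(1) assms(2) by (auto simp: total_def)
  ultimately show ?thesis
    using face_total_Int_span(1)[OF a assms(2)] proper_face_piece[OF assms(2)] by blast
qed

text \<open>\<open>F\<close> is generated by the points of \<open>total\<close> on its hyperplane,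
  and each of them lies in a single \<open>S i\<close>. So the pieces determine \<open>F\<close>,
  which yields injectivity below.\<close>

lemma proper_face_eq_hull_Union:
  assumes "proper_face F (convex hull total)"
  shows "F = convex hull (\<Union>i\<in>I. F \<inter> span (S i))"
proof -
  obtain a where a: "\<forall>x\<in>total. a \<bullet> x \<le> 1" "F = convex hull total \<inter> {x. a \<bullet> x = 1}"
    using assms proper_face_total by auto
  have F: "F = convex hull {x\<in>total. a \<bullet> x = 1}"
    unfolding a(2) using a(1) finite_total by (intro convex_hull_Int_supporting_hyperplane)
  have "{x\<in>total. a \<bullet> x = 1} \<subseteq> (\<Union>i\<in>I. F \<inter> span (S i))"
  proof
    fix x assume x: "x \<in> {x\<in>total. a \<bullet> x = 1}"
    then have "x \<in> F" using a(2) by (simp add: hull_inc)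
    with x show "x \<in> (\<Union>i\<in>I. F \<inter> span (S i))"
      unfolding total_def using span_base by blast
  qed
  then have "F \<subseteq> convex hull (\<Union>i\<in>I. F \<inter> span (S i))"
    by (subst F) (rule hull_mono)
  moreover have "convex F"
    by (subst F) (rule convex_convex_hull)
  then have "convex hull (\<Union>i\<in>I. F \<inter> span (S i)) \<subseteq> F"
    by (intro hull_minimal) auto
  ultimately show ?thesis by blast
qed

lemma bij_betw_proper_faces:
  "bij_betw (\<lambda>F. \<lambda>i\<in>I. F \<inter> span (S i)) {F. proper_face F (convex hull total)}
     (\<Pi>\<^sub>E i\<in>I. {G. proper_face G (convex hull S i)})"
  unfolding bij_betw_def
proof
  show "inj_on (\<lambda>F. \<lambda>i\<in>I. F \<inter> span (S i)) {F. proper_face F (convex hull total)}"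
  proof (rule inj_onI, clarsimp)
    fix F G
    assume F: "proper_face F (convex hull total)" and G: "proper_face G (convex hull total)"
      and eq: "(\<lambda>i\<in>I. F \<inter> span (S i)) = (\<lambda>i\<in>I. G \<inter> span (S i))"
    have "F \<inter> span (S i) = G \<inter> span (S i)" if "i \<in> I" for i
      using fun_cong[OF eq, of i] that by simp
    then show "F = G"
      using proper_face_eq_hull_Union[OF F] proper_face_eq_hull_Union[OF G] by simp
  qed
next
  show "(\<lambda>F. \<lambda>i\<in>I. F \<inter> span (S i)) ` {F. proper_face F (convex hull total)} =
        (\<Pi>\<^sub>E i\<in>I. {G. proper_face G (convex hull S i)})"
  proof (intro equalityI subsetI)
    fix G assume G: "G \<in> (\<Pi>\<^sub>E i\<in>I. {G. proper_face G (convex hull S i)})"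
    \<comment> \<open>The defining vector of each \<open>G i\<close> is taken inside
      \<open>span (S i)\<close>, so that it vanishes on all the other pieces.\<close>
    have "\<exists>b. b \<in> span (S i) \<and> (\<forall>x\<in>S i. b \<bullet> x \<le> 1) \<and> G i = convex hull {x\<in>S i. b \<bullet> x = 1}"
      if i: "i \<in> I" for i
    proof -
      have "proper_face (G i) (convex hull S i)" using G i by auto
      then obtain a where a: "\<forall>x\<in>S i. a \<bullet> x \<le> 1" "G i = convex hull S i \<inter> {x. a \<bullet> x = 1}"
        using proper_face_piece[OF i] by auto
      \<comment> \<open>\<open>b\<close> is the orthogonal projection of \<open>a\<close>; it
        induces the same functional on \<open>S i\<close>.\<close>
      obtain b z where b: "b \<in> span (S i)" "\<And>w. w \<in> span (S i) \<Longrightarrow> orthogonal z w" "a = b + z"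
        using orthogonal_subspace_decomp_exists by blast
      have ba: "b \<bullet> x = a \<bullet> x" if "x \<in> S i" for x
        using b(2)[OF span_base[OF that]] b(3) by (simp add: orthogonal_def inner_add_left)
      have "G i = convex hull {x\<in>S i. a \<bullet> x = 1}"
        unfolding a(2) using a(1) finite_piece[OF i]
        by (intro convex_hull_Int_supporting_hyperplane)
      also have "{x\<in>S i. a \<bullet> x = 1} = {x\<in>S i. b \<bullet> x = 1}" using ba by auto
      finally show ?thesis using b(1) a(1) ba by auto
    qed
    then obtain b where b: "\<And>i. i \<in> I \<Longrightarrow> b i \<in> span (S i)"
        "\<And>i x. i \<in> I \<Longrightarrow> x \<in> S i \<Longrightarrow> b i \<bullet> x \<le> 1"
        "\<And>i. i \<in> I \<Longrightarrow> G i = convex hull {x\<in>S i. b i \<bullet> x = 1}"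
      by metis
    \<comment> \<open>Gluing: on \<open>S i\<close> only the summand \<open>b i\<close> contributes,
      so \<open>a\<close> satisfies all the local conditions at once.\<close>
    define a where "a = (\<Sum>i\<in>I. b i)"
    have ab: "a \<bullet> x = b i \<bullet> x" if "i \<in> I" "x \<in> S i" for i x
      using inner_sum_pieces[of I b i x "\<lambda>_. 1"] b(1) that by (simp add: a_def span_base)
    define F where "F = convex hull total \<inter> {x. a \<bullet> x = 1}"
    have a1: "\<forall>x\<in>total. a \<bullet> x \<le> 1"
      using ab b(2) by (auto simp: total_def)
    have "F \<inter> span (S i) = G i" if i: "i \<in> I" for i
    proof -
      have "{x\<in>S i. a \<bullet> x = 1} = {x\<in>S i. b i \<bullet> x = 1}" using ab i by auto
      then show ?thesis
        using face_total_Int_span(2)[OF a1 F_def i] b(3)[OF i] by simp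
    qed
    then have "G = (\<lambda>i\<in>I. F \<inter> span (S i))"
      using G by (intro ext) (auto simp: PiE_def extensional_def)
    moreover have "proper_face F (convex hull total)"
      using a1 F_def proper_face_total by auto
    ultimately show "G \<in> (\<lambda>F. \<lambda>i\<in>I. F \<inter> span (S i)) ` {F. proper_face F (convex hull total)}"
      by blast
  next
    fix G
    assume "G \<in> (\<lambda>F. \<lambda>i\<in>I. F \<inter> span (S i)) ` {F. proper_face F (convex hull total)}"
    then show "G \<in> (\<Pi>\<^sub>E i\<in>I. {G. proper_face G (convex hull S i)})"
      using proper_face_Int_span by fastforce
  qed
qed

text \<open>\<open>F\<close> and all its pieces lie in one hyperplane missing the origin, so each
  affine dimension is a linear one minus 1, and linear dimensions of orthogonal sets add.\<close>

lemma aff_dim_proper_face: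
  assumes "proper_face F (convex hull total)"
  shows "aff_dim F = int (card I) - 1 + (\<Sum>i\<in>I. aff_dim (F \<inter> span (S i)))"
proof -
  obtain a where a: "\<forall>x\<in>total. a \<bullet> x \<le> 1" "F = convex hull total \<inter> {x. a \<bullet> x = 1}"
    using assms proper_face_total by auto
  define T where "T i = {x\<in>S i. a \<bullet> x = 1}" for i
  have "F = convex hull {x\<in>total. a \<bullet> x = 1}"
    unfolding a(2) using a(1) finite_total by (intro convex_hull_Int_supporting_hyperplane)
  also have "{x\<in>total. a \<bullet> x = 1} = (\<Union>i\<in>I. T i)"
    by (auto simp: total_def T_def)
  finally have "aff_dim F = aff_dim (\<Union>i\<in>I. T i)"
    by (simp add: aff_dim_convex_hull)
  also have "\<dots> = int (dim (\<Union>i\<in>I. T i)) - 1"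
    by (rule aff_dim_in_hyperplane_one[of _ a]) (auto simp: T_def)
  also have "dim (\<Union>i\<in>I. T i) = (\<Sum>i\<in>I. dim (T i))"
    using finite_index orthogonal_pieces by (intro dim_Union_orthogonal) (auto simp: T_def)
  \<comment> \<open>The shift by 1 occurs once per index, empty pieces included, and accounts for
    \<open>card I\<close> in the formula.\<close>
  also have "int (\<Sum>i\<in>I. dim (T i)) = (\<Sum>i\<in>I. aff_dim (F \<inter> span (S i)) + 1)"
    unfolding of_nat_sum
  proof (rule sum.cong[OF refl])
    fix i assume "i \<in> I"
    then have "aff_dim (F \<inter> span (S i)) = aff_dim (T i)"
      using face_total_Int_span(2)[OF a] by (simp add: aff_dim_convex_hull T_def)
    also have "\<dots> = int (dim (T i)) - 1"
      by (rule aff_dim_in_hyperplane_one[of _ a]) (auto simp: T_def)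
    finally show "int (dim (T i)) = aff_dim (F \<inter> span (S i)) + 1" by simp
  qed
  finally show ?thesis by (simp add: sum.distrib)
qed

section \<open>Relative interiors and dominance\<close>

text \<open>\<open>F\<close> is the hull of finitely many convex pieces, whose relative interior
  consists of the strictly positive combinations of relatively interior points. An empty piece has
  no point to contribute, hence the restriction to \<open>J\<close>.\<close>

lemma rel_interior_proper_face:
  assumes "proper_face F (convex hull total)"
  defines "J \<equiv> {i\<in>I. F \<inter> span (S i) \<noteq> {}}"
  shows "rel_interior F =
    {\<Sum>i\<in>J. c i *\<^sub>R s i | c s. (\<forall>i\<in>J. c i > 0) \<and> sum c J = 1 \<and>
       (\<forall>i\<in>J. s i \<in> rel_interior (F \<inter> span (S i)))}"
proof -
  have "convex F"
    using assms(1) face_of_imp_convex proper_face_def by blast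
  then have "convex (F \<inter> span (S i))" for i
    by (simp add: convex_Int subspace_imp_convex)
  moreover have "(\<Union>i\<in>I. F \<inter> span (S i)) = (\<Union>i\<in>J. F \<inter> span (S i))"
    by (auto simp: J_def)
  then have "F = convex hull (\<Union>i\<in>J. F \<inter> span (S i))"
    using proper_face_eq_hull_Union[OF assms(1)] by (rule subst)
  moreover have "finite J" using finite_index by (simp add: J_def)
  moreover have "\<forall>i\<in>J. F \<inter> span (S i) \<noteq> {}" by (simp add: J_def)
  ultimately show ?thesis
    using rel_interior_convex_hull_union[of J "\<lambda>i. F \<inter> span (S i)"] by metis
qed

text \<open>Pairing a relatively interior point with a root of \<open>S j\<close> sees only its j-th
  part, scaled by a positive weight. The sign conditions therefore decouple. \<open>D\<close> will
  be the set of simple roots.\<close>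

lemma dominant_proper_face_iff:
  assumes F: "proper_face F (convex hull total)" and D: "D \<subseteq> total"
  shows "F = {} \<or> (\<exists>x\<in>rel_interior F. \<forall>\<alpha>\<in>D. 0 \<le> x \<bullet> \<alpha>) \<longleftrightarrow>
    (\<forall>i\<in>I. F \<inter> span (S i) = {} \<or>
       (\<exists>x\<in>rel_interior (F \<inter> span (S i)). \<forall>\<alpha>\<in>D \<inter> S i. 0 \<le> x \<bullet> \<alpha>))"
    (is "?L \<longleftrightarrow> ?R")
proof
  define J where "J = {i\<in>I. F \<inter> span (S i) \<noteq> {}}"
  note ri = rel_interior_proper_face[OF F, folded J_def]
  have J: "J \<subseteq> I" "finite J" using finite_index by (auto simp: J_def)
  have spn: "s \<in> span (S i)" if "s \<in> rel_interior (F \<inter> span (S i))" for s i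
    using that rel_interior_subset by blast
  show ?R if L: ?L
  proof (intro ballI disjCI)
    fix i assume i: "i \<in> I"
      and "\<not> (\<exists>x\<in>rel_interior (F \<inter> span (S i)). \<forall>\<alpha>\<in>D \<inter> S i. 0 \<le> x \<bullet> \<alpha>)"
    show "F \<inter> span (S i) = {}"
    proof (rule ccontr)
      assume ne: "F \<inter> span (S i) \<noteq> {}"
      with i have iJ: "i \<in> J" by (simp add: J_def)
      obtain x where x: "x \<in> rel_interior F" "\<forall>\<alpha>\<in>D. 0 \<le> x \<bullet> \<alpha>"
        using L ne by auto
      obtain c s where cs: "x = (\<Sum>i\<in>J. c i *\<^sub>R s i)" "\<forall>i\<in>J. c i > 0"
          "\<forall>i\<in>J. s i \<in> rel_interior (F \<inter> span (S i))"
        using x(1) unfolding ri by auto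
      \<comment> \<open>The component \<open>s i\<close> of the dominant point \<open>x\<close> is
        the witness for the piece; dividing by \<open>c i > 0\<close> keeps the sign.\<close>
      have "0 \<le> s i \<bullet> \<alpha>" if "\<alpha> \<in> D \<inter> S i" for \<alpha>
      proof -
        have "0 \<le> x \<bullet> \<alpha>" using x(2) that by auto
        also have "x \<bullet> \<alpha> = c i * (s i \<bullet> \<alpha>)"
          using inner_sum_pieces[of J s i \<alpha> c] J cs spn i iJ that by (auto simp: span_base)
        finally show ?thesis using cs(2) iJ by (simp add: zero_le_mult_iff) (smt (verit))
      qed
      with cs(3) iJ show False
        using \<open>\<not> (\<exists>x\<in>_. _)\<close> by blast
    qed
  qed
  show ?L if R: ?R
  proof (cases "J = {}")
    case True
    then have "(\<Union>i\<in>I. F \<inter> span (S i)) = {}" by (auto simp: J_def)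
    then show ?thesis using proper_face_eq_hull_Union[OF F] by simp
  next
    case False
    have "\<forall>i\<in>J. \<exists>x\<in>rel_interior (F \<inter> span (S i)). \<forall>\<alpha>\<in>D \<inter> S i. 0 \<le> x \<bullet> \<alpha>"
      using R by (auto simp: J_def)
    then obtain s where s: "\<forall>i\<in>J. s i \<in> rel_interior (F \<inter> span (S i))"
        "\<And>i \<alpha>. i \<in> J \<Longrightarrow> \<alpha> \<in> D \<inter> S i \<Longrightarrow> 0 \<le> s i \<bullet> \<alpha>"
      by metis
    \<comment> \<open>Any positive weights with sum 1 would do; the point built from them is the
      barycentre of the chosen dominant points.\<close>
    define c where "c = (\<lambda>i::'i. 1 / real (card J))"
    have c: "\<forall>i\<in>J. c i > 0" "sum c J = 1"
      using False J by (auto simp: c_def card_gt_0_iff)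
    define x where "x = (\<Sum>i\<in>J. c i *\<^sub>R s i)"
    have "x \<in> rel_interior F"
      unfolding ri x_def using s(1) c by blast
    moreover have "0 \<le> x \<bullet> \<alpha>" if \<alpha>: "\<alpha> \<in> D" for \<alpha>
    proof -
      obtain j where j: "j \<in> I" "\<alpha> \<in> S j" using D \<alpha> unfolding total_def by blast
      \<comment> \<open>If the j-th piece is empty, \<open>x\<close> is orthogonal to \<alpha> and
        the condition holds with equality.\<close>
      have "x \<bullet> \<alpha> = (if j \<in> J then c j * (s j \<bullet> \<alpha>) else 0)"
        unfolding x_def using J s(1) spn j by (intro inner_sum_pieces) (auto simp: span_base)
      then show ?thesis using c(1) s(2) j \<alpha> by (simp add: less_imp_le)
    qed
    ultimately show ?thesis by blast
  qed
qed

end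

section \<open>Irreducible components\<close>

lemma root_system_uminus:
  assumes "root_system \<Phi>" "\<alpha> \<in> \<Phi>"
  shows "- \<alpha> \<in> \<Phi>"
proof -
  have "\<alpha> \<noteq> 0" using assms by (auto simp: root_system_def)
  then have "root_reflection \<alpha> \<alpha> = - \<alpha>"
    by (simp add: root_reflection_def scaleR_2)
  moreover have "root_reflection \<alpha> ` \<Phi> = \<Phi>"
    using assms by (simp add: root_system_def)
  ultimately show ?thesis
    using assms(2) by (metis imageI)
qed

lemma irreducible_componentsD:
  assumes "\<Psi> \<in> irreducible_components \<Phi>"
  shows "\<Psi> \<subseteq> \<Phi>" "irreducible_root_system \<Psi>" "root_system \<Psi>" "\<Psi> \<noteq> {}"
    and "\<And>\<alpha> \<beta>. \<alpha> \<in> \<Psi> \<Longrightarrow> \<beta> \<in> \<Phi> - \<Psi> \<Longrightarrow> \<alpha> \<bullet> \<beta> = 0"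
  using assms by (simp_all add: irreducible_components_def irreducible_root_system_def)

text \<open>Otherwise \<open>A \<inter> B\<close> and \<open>A - B\<close> would split
  \<open>A\<close> orthogonally, against irreducibility. By symmetry, components that meet
  coincide.\<close>

lemma irreducible_component_subset:
  assumes "A \<in> irreducible_components \<Phi>" "B \<in> irreducible_components \<Phi>" "A \<inter> B \<noteq> {}"
  shows "A \<subseteq> B"
proof (rule ccontr)
  assume "\<not> A \<subseteq> B"
  then have "A \<inter> B \<noteq> {}" "A - B \<noteq> {}" "(A \<inter> B) \<union> (A - B) = A" "(A \<inter> B) \<inter> (A - B) = {}"
    using assms(3) by auto
  moreover have "\<forall>\<alpha>\<in>A \<inter> B. \<forall>\<beta>\<in>A - B. \<alpha> \<bullet> \<beta> = 0"
    using irreducible_componentsD(5)[OF assms(2)] irreducible_componentsD(1)[OF assms(1)] by blast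
  ultimately show False
    using irreducible_componentsD(2)[OF assms(1)] unfolding irreducible_root_system_def by metis
qed

lemma irreducible_components_orthogonal:
  assumes "A \<in> irreducible_components \<Phi>" "B \<in> irreducible_components \<Phi>" "A \<noteq> B"
    and "\<alpha> \<in> A" "\<beta> \<in> B"
  shows "\<alpha> \<bullet> \<beta> = 0"
proof -
  have "A \<inter> B = {}"
    using irreducible_component_subset assms by (metis Int_commute subset_antisym)
  then show ?thesis
    using irreducible_componentsD(5)[OF assms(1)] irreducible_componentsD(1)[OF assms(2)]
      assms(4,5) by blast
qed

text \<open>The point is stability under reflections. If the reflection \<open>x\<close> of \<gamma>
  in \<beta> left \<open>A\<close>, it would be orthogonal to both \<beta> and \<gamma>, hence to
  itself, being a combination of them.\<close>

lemma root_system_orthogonal_summand: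
  assumes \<Phi>: "root_system \<Phi>" and A: "A \<subseteq> \<Phi>"
    and orth: "\<And>\<alpha> \<beta>. \<alpha> \<in> A \<Longrightarrow> \<beta> \<in> \<Phi> - A \<Longrightarrow> \<alpha> \<bullet> \<beta> = 0"
  shows "root_system A"
proof -
  have "finite A" using \<Phi> A finite_subset unfolding root_system_def by blast
  have "root_reflection \<beta> ` A = A" if \<beta>: "\<beta> \<in> A" for \<beta>
  proof (rule endo_inj_surj[OF \<open>finite A\<close>])
    show "root_reflection \<beta> ` A \<subseteq> A"
    proof
      fix x assume "x \<in> root_reflection \<beta> ` A"
      then obtain \<gamma> where \<gamma>: "\<gamma> \<in> A" "x = root_reflection \<beta> \<gamma>" by auto
      have x: "x \<in> \<Phi>" using \<Phi> \<beta> \<gamma> A unfolding root_system_def by blast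
      show "x \<in> A"
      proof (rule ccontr)
        assume "x \<notin> A"
        then have "\<gamma> \<bullet> x = 0" "\<beta> \<bullet> x = 0" using orth x \<beta> \<gamma> by auto
        then have "x \<bullet> x = 0"
          by (subst (1) \<gamma>(2)) (simp add: root_reflection_def inner_diff_left)
        then show False using x \<Phi> by (simp add: root_system_def)
      qed
    qed
    \<comment> \<open>The reflection maps the finite set \<Phi> onto itself, so it is injective
      there.\<close>
    have "inj_on (root_reflection \<beta>) \<Phi>"
      using \<Phi> \<beta> A unfolding root_system_def by (intro eq_card_imp_inj_on) auto
    then show "inj_on (root_reflection \<beta>) A" using A by (rule inj_on_subset)
  qed
  moreover have "2 * (\<beta> \<bullet> \<alpha>) / (\<alpha> \<bullet> \<alpha>) \<in> \<int>" if "\<alpha> \<in> A" "\<beta> \<in> A" for \<alpha> \<beta>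
    using \<Phi> subsetD[OF A that(1)] subsetD[OF A that(2)] by (simp add: root_system_def)
  moreover have "c = 1 \<or> c = - 1" if "\<alpha> \<in> A" "c *\<^sub>R \<alpha> \<in> A" for \<alpha> c
    using \<Phi> subsetD[OF A that(1)] subsetD[OF A that(2)] by (simp add: root_system_def)
  moreover have "0 \<notin> A" using \<Phi> A by (auto simp: root_system_def)
  ultimately show ?thesis
    using \<open>finite A\<close> unfolding root_system_def by simp
qed

text \<open>The component of \<alpha> is found as a set of least cardinality among those that
  contain \<alpha> and are orthogonal to their complement in \<Phi>.\<close>

lemma Union_irreducible_components:
  assumes \<Phi>: "root_system \<Phi>"
  shows "\<Union> (irreducible_components \<Phi>) = \<Phi>"
proof
  show "\<Union> (irreducible_components \<Phi>) \<subseteq> \<Phi>"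
    by (auto simp: irreducible_components_def)
  show "\<Phi> \<subseteq> \<Union> (irreducible_components \<Phi>)"
  proof
    fix \<alpha> assume \<alpha>: "\<alpha> \<in> \<Phi>"
    define Q where "Q A \<longleftrightarrow> A \<subseteq> \<Phi> \<and> \<alpha> \<in> A \<and> (\<forall>\<beta>\<in>A. \<forall>\<gamma>\<in>\<Phi> - A. \<beta> \<bullet> \<gamma> = 0)" for A
    have "Q \<Phi>" using \<alpha> by (simp add: Q_def)
    then obtain A where A: "Q A" and min: "\<And>B. Q B \<Longrightarrow> card A \<le> card B"
      using ex_has_least_nat[of Q \<Phi> card] by blast
    have "finite A" using A \<Phi> finite_subset[of A \<Phi>] by (simp add: Q_def root_system_def)
    have no_split: False
      if BC: "B \<union> C = A" "B \<inter> C = {}" "C \<noteq> {}" "\<alpha> \<in> B" "\<forall>\<beta>\<in>B. \<forall>\<gamma>\<in>C. \<beta> \<bullet> \<gamma> = 0" for B C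
    proof -
      \<comment> \<open>\<open>B\<close> is orthogonal to \<open>C\<close> and, as part of
        \<open>A\<close>, to \<Phi> outside \<open>A\<close>; being a proper subset of
        \<open>A\<close>, it contradicts minimality.\<close>
      have "Q B" using A BC unfolding Q_def by blast
      then have "card A \<le> card B" by (rule min)
      moreover have "card B < card A"
        using BC \<open>finite A\<close> by (intro psubset_card_mono) auto
      ultimately show False by simp
    qed
    have "\<not> (\<exists>B C. B \<noteq> {} \<and> C \<noteq> {} \<and> B \<union> C = A \<and> B \<inter> C = {} \<and>
              (\<forall>\<beta>\<in>B. \<forall>\<gamma>\<in>C. \<beta> \<bullet> \<gamma> = 0))"
    proof clarify
      fix B C assume BC: "B \<noteq> {}" "C \<noteq> {}" "A = B \<union> C" "B \<inter> C = {}"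
        "\<forall>\<beta>\<in>B. \<forall>\<gamma>\<in>C. \<beta> \<bullet> \<gamma> = 0"
      then consider "\<alpha> \<in> B" | "\<alpha> \<in> C" using A unfolding Q_def by auto
      then show False
      proof cases
        case 1
        with no_split[of B C] BC show ?thesis by simp
      next
        case 2
        moreover have "\<forall>\<beta>\<in>C. \<forall>\<gamma>\<in>B. \<beta> \<bullet> \<gamma> = 0" using BC(5) inner_commute by metis
        ultimately show ?thesis using no_split[of C B] BC by (simp add: Un_commute Int_commute)
      qed
    qed
    moreover have "root_system A"
      using A by (intro root_system_orthogonal_summand[OF \<Phi>]) (auto simp: Q_def)
    ultimately have "A \<in> irreducible_components \<Phi>"
      using A by (auto simp: Q_def irreducible_components_def irreducible_root_system_def)
    then show "\<alpha> \<in> \<Union> (irreducible_components \<Phi>)"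
      using A by (auto simp: Q_def)
  qed
qed

section \<open>Standard faces of root polytopes\<close>

text \<open>Every face lies in \<open>span \<Phi>\<close>, so meeting the chamber reduces to the
  sign conditions on \<Delta>.\<close>

lemma standard_face_iff:
  assumes "F face_of root_polytope \<Phi>"
  shows "standard_face \<Phi> \<Delta> F \<longleftrightarrow>
    F = {} \<or> (\<exists>x\<in>rel_interior F. \<forall>\<alpha>\<in>\<Delta>. 0 \<le> x \<bullet> \<alpha>)"
proof -
  have "rel_interior F \<subseteq> F" by (rule rel_interior_subset)
  also have "F \<subseteq> convex hull \<Phi>"
    using assms face_of_imp_subset by (auto simp: root_polytope_def)
  also have "\<dots> \<subseteq> span \<Phi>" by (rule convex_hull_subset_span)
  finally show ?thesis
    using assms unfolding standard_face_def fundamental_chamber_def by blast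
qed

theorem proposition3p10:
  fixes \<Phi> \<Delta> :: "'a::euclidean_space set"
    and \<Phi>c :: "nat \<Rightarrow> 'a set" and k :: nat
  assumes "root_system \<Phi>" and "\<Phi> \<noteq> {}"
    and "simple_roots \<Phi> \<Delta>"
    and "bij_betw \<Phi>c {1..k} (irreducible_components \<Phi>)"
  shows "bij_betw (\<lambda>F. \<lambda>i\<in>{1..k}. F \<inter> span (\<Phi>c i))
           {F. proper_face F (root_polytope \<Phi>)}
           (\<Pi>\<^sub>E i\<in>{1..k}. {G. proper_face G (root_polytope (\<Phi>c i))})
       \<and> (\<forall>F. proper_face F (root_polytope \<Phi>) \<longrightarrow>
           aff_dim F = int k - 1 + (\<Sum>i=1..k. aff_dim (F \<inter> span (\<Phi>c i))))
       \<and> (\<forall>F. F face_of root_polytope \<Phi> \<longrightarrow>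
           (standard_face \<Phi> \<Delta> F \<longleftrightarrow>
            (\<forall>i\<in>{1..k}. standard_face (\<Phi>c i) (\<Delta> \<inter> \<Phi>c i) (F \<inter> span (\<Phi>c i)))))"
proof -
  have comp: "\<Phi>c i \<in> irreducible_components \<Phi>" if "i \<in> {1..k}" for i
    using assms(4) that by (auto simp: bij_betw_def)
  have Un: "(\<Union>i\<in>{1..k}. \<Phi>c i) = \<Phi>"
    using assms(4) Union_irreducible_components[OF assms(1)] by (auto simp: bij_betw_def)
  interpret orthogonal_pieces "{1..k}" \<Phi>c
  proof
    \<comment> \<open>A nonempty \<Phi> has at least one component, so \<open>k\<close> is at least
      1.\<close>
    show "{1..k} \<noteq> {}" using Un assms(2) by auto
    fix i assume i: "i \<in> {1..k}"
    note c = irreducible_componentsD[OF comp[OF i]]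
    show "finite (\<Phi>c i)" using c(3) by (simp add: root_system_def)
    show "\<Phi>c i \<noteq> {}" by (rule c(4))
    show "- x \<in> \<Phi>c i" if "x \<in> \<Phi>c i" for x
      using root_system_uminus c(3) that by blast
    fix j x y assume j: "j \<in> {1..k}" "i \<noteq> j" and xy: "x \<in> \<Phi>c i" "y \<in> \<Phi>c j"
    have "\<Phi>c i \<noteq> \<Phi>c j"
      using bij_betw_imp_inj_on[OF assms(4)] i j by (metis inj_onD)
    then show "x \<bullet> y = 0"
      using irreducible_components_orthogonal comp i j(1) xy by blast
  qed simp
  have tot: "total = \<Phi>" unfolding total_def by (rule Un)
  have D: "\<Delta> \<subseteq> total" using assms(3) tot by (simp add: simple_roots_def)
  have "standard_face \<Phi> \<Delta> F \<longleftrightarrow>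
      (\<forall>i\<in>{1..k}. standard_face (\<Phi>c i) (\<Delta> \<inter> \<Phi>c i) (F \<inter> span (\<Phi>c i)))"
    if F: "F face_of root_polytope \<Phi>" for F
  proof (cases "F = root_polytope \<Phi>")
    case True
    have Fi: "F \<inter> span (\<Phi>c i) = root_polytope (\<Phi>c i)" if "i \<in> {1..k}" for i
      using convex_hull_total_Int_span[OF that] True tot by (simp add: root_polytope_def)
    have "standard_face (\<Phi>c i) (\<Delta> \<inter> \<Phi>c i) (F \<inter> span (\<Phi>c i))" if "i \<in> {1..k}" for i
      unfolding Fi[OF that] using zero_in_rel_interior_piece[OF that]
      by (subst standard_face_iff)
         (auto simp: root_polytope_def face_of_refl intro!: bexI[of _ 0])
    moreover have "standard_face \<Phi> \<Delta> F"
      unfolding True using zero_in_rel_interior_total tot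
      by (subst standard_face_iff)
         (auto simp: root_polytope_def face_of_refl intro!: bexI[of _ 0])
    ultimately show ?thesis by blast
  next
    case False
    then have F': "proper_face F (convex hull total)"
      using F tot by (simp add: proper_face_def root_polytope_def)
    have "F \<inter> span (\<Phi>c i) face_of root_polytope (\<Phi>c i)" if "i \<in> {1..k}" for i
      using proper_face_Int_span[OF F' that] by (simp add: proper_face_def root_polytope_def)
    then show ?thesis
      using dominant_proper_face_iff[OF F' D] F by (simp add: standard_face_iff)
  qed
  then show ?thesis
    using bij_betw_proper_faces aff_dim_proper_face tot by (simp add: root_polytope_def)
qed

end
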